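(* Let $m\ge 1$ and let $T_i=(Q_i,q_i^0,\to_i,\Pi,L_i,w_i)$, $i=1,\dots,m$, be weighted transition systems with positive integer weights, and let $R$ be the associated region automaton of the team (defined in the context). Given runs $r_i=q_i^0q_i^1\cdots$ of $T_i$ for $i=1,\dots,m$, there is a corresponding run $r_R$ of $R$ such that the word $\omega$ generated by the team following $(r_1,\dots,r_m)$ equals the word $\omega_R$ of $r_R$, and the time sequence $\mathbb{T}$ of satisfying instances of propositions for the team equals the time sequence $\mathbb{T}_R$ of $r_R$.
   Context: **Transition systems.** A weighted transition system $T_i=(Q_i,q_i^0,\to_i,\Pi,L_i,w_i)$ consists of a finite set of states $Q_i$, an initial state $q_i^0\in Q_i$, a transition relation $\to_i\subseteq Q_i\times Q_i$, a finite set of atomic propositions $\Pi$ (common to all $i$), a labelling $L_i:Q_i\to 2^\Pi$, and weights $w_i$ assigning a positive integer to each transition ($w_i(a,b)$ is the time robot $i$ needs to go from $a$ to $b$; robots spend zero time at states). A run of $T_i$ is an infinite sequence $q_i^0q_i^1q_i^2\cdots$ starting at the initial state with $(q_i^k,q_i^{k+1})\in\to_i$ for all $k\ge 0$. **Team behaviour.** Given runs $r_i=q_i^0q_i^1\cdots$ of $T_i$, let $t_i^0=0$ and $t_i^{k+1}=t_i^k+w_i(q_i^k,q_i^{k+1})$. Let $\mathbb{T}=t^0t^1\cdots$ be the set $\bigcup_{i=1}^m\{t_i^k:k\ge0\}$ listed in increasing order. The word generated by the team is $\omega=\omega^0\omega^1\cdots$ with $\omega^k=\bigcup\{L_i(q_i^j):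 1\le i\le m,\ j\ge 0,\ t_i^j=t^k\}$. **Dual systems.** The dual $D_i$ of $T_i$ has states $ab$ for each $(a,b)\in\to_i$, together with one extra initial state $q^0_{D_i}$. Its transitions are $(ab,bc)$ for $(a,b),(b,c)\in\to_i$, and $(q^0_{D_i},q_i^0b)$ for $(q_i^0,b)\in\to_i$. A transition of $D_i$ with target $bc$ carries the label $L_i(b)$. Each state of $D_i$ has a duration: $c_i(ab)=w_i(a,b)$, $c_i(q^0_{D_i})=0$. **Region automaton $R$.** Robot $i$ has a clock $x_i$ measuring the time spent in the current state of $D_i$; it must leave a state as soon as the clock reaches the duration of that state (constraint $x_i\ge c_i$), at which moment the clock is reset to $0$. The states of $R$ are the pairs $\{q,v\}$, with $q=(q_1,\dots,q_m)$, $q_i$ a state of $D_i$, and $v=(v_1,\dots,v_m)$ a tuple of clock values, reachable from the initial state $\{(q^0_{D_1},\dots,q^0_{D_m}),(0,\dots,0)\}$ under the following transitions. Given $\{q,v\}$, let $\tau$ be the least $t\ge0$ such that $v_i+t\ge c_i(q_i)$ for some $i$, and $I=\{i: v_i+\tau\ge c_i(q_i)\}$. Then $\{q,v\}\to_R\{q',v'\}$ iff for $i\in I$, $(q_i,q_i')$ is a transition of $D_i$ and $v_i'=0$, and for $i\notin I$, $q_i'=q_i$ and $v_i'=v_i+\tau$. The weight of this transition is $\tau$, and the target state $\{q',v'\}$ is labelled by the union over $i\in I$ of the labels of the transitions $(q_i,q_i')$ of $D_i$. **Runs of $R$.** A run of $R$ is an infinite path from the initial state. The initial state only serves as a dummy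 start that is left at time $0$; the word $\omega_R$ of a run $r_R$ is the sequence of labels of its states after the dummy initial state, and $\mathbb{T}_R$ is the sequence of times (accumulated weights) at which these states are reached. *)

theory Defs
  imports Complex_Main "HOL-Library.Infinite_Set"
begin

section \<open>Weighted transition systems and their runs\<close>

record ('q, 'p) wts =
  states :: "'q set"
  init :: 'q
  trans :: "('q \<times> 'q) set"
  props :: "'p set"
  label :: "'q \<Rightarrow> 'p set"
  weight :: "'q \<Rightarrow> 'q \<Rightarrow> nat"

definition weighted_ts :: "('q, 'p) wts \<Rightarrow> bool" where
  "weighted_ts T \<longleftrightarrow>
     finite (states T) \<and> init T \<in> states T \<and> trans T \<subseteq> states T \<times> states T \<and>
     finite (props T) \<and> (\<forall>a\<in>states T. label T a \<subseteq> props T) \<and>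
     (\<forall>(a, b)\<in>trans T. weight T a b > 0)"

definition is_run :: "('q, 'p) wts \<Rightarrow> (nat \<Rightarrow> 'q) \<Rightarrow> bool" where
  "is_run T r \<longleftrightarrow> r 0 = init T \<and> (\<forall>k. (r k, r (Suc k)) \<in> trans T)"


section \<open>Team behaviour\<close>

text \<open>The robots are indexed by a finite type \<open>'r\<close>; their number is \<open>CARD('r) \<ge> 1\<close>.\<close>

primrec arrival :: "('q, 'p) wts \<Rightarrow> (nat \<Rightarrow> 'q) \<Rightarrow> nat \<Rightarrow> nat" where
  "arrival T r 0 = 0"
| "arrival T r (Suc k) = arrival T r k + weight T (r k) (r (Suc k))"

definition team_instants :: "('r::finite \<Rightarrow> ('q, 'p) wts) \<Rightarrow> ('r \<Rightarrow> nat \<Rightarrow> 'q) \<Rightarrow> nat set" where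
  "team_instants T r = (\<Union>i. range (arrival (T i) (r i)))"

text \<open>The increasing listing is meaningful because the set of instants is infinite; see
  \<open>infinite_team_instants\<close> below.\<close>

definition team_time :: "('r::finite \<Rightarrow> ('q, 'p) wts) \<Rightarrow> ('r \<Rightarrow> nat \<Rightarrow> 'q) \<Rightarrow> nat \<Rightarrow> nat" where
  "team_time T r = enumerate (team_instants T r)"

definition team_word :: "('r::finite \<Rightarrow> ('q, 'p) wts) \<Rightarrow> ('r \<Rightarrow> nat \<Rightarrow> 'q) \<Rightarrow> nat \<Rightarrow> 'p set" where
  "team_word T r k =
     \<Union>{label (T i) (r i j) | i j. arrival (T i) (r i) j = team_time T r k}"

lemma infinite_team_instants:
  fixes T :: "'r::finite \<Rightarrow> ('q, 'p) wts"
  assumes "\<And>i. weighted_ts (T i)" "\<And>i. is_run (T i) (r i)"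
  shows "infinite (team_instants T r)"
proof -
  fix i :: 'r
  have "arrival (T i) (r i) k < arrival (T i) (r i) (Suc k)" for k
    using assms[of i] by (fastforce simp: weighted_ts_def is_run_def)
  then have "strict_mono (arrival (T i) (r i))"
    by (simp add: strict_mono_Suc_iff)
  then have "infinite (range (arrival (T i) (r i)))"
    using finite_imageD strict_mono_imp_inj_on by blast
  then show ?thesis
    unfolding team_instants_def by (meson UN_upper finite_subset UNIV_I)
qed


section \<open>Dual systems\<close>

datatype 'q dual_state = Start | Pair_State 'q 'q

record ('s, 'p) dual_system =
  dstates :: "'s set"
  dinit :: 's
  dtrans :: "('s \<times> 's) set"
  dlabel :: "'s \<times> 's \<Rightarrow> 'p set"
  duration :: "'s \<Rightarrow> nat"

text \<open>No transition has target \<open>Start\<close>, so its label in that case is irrelevant.\<close>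

definition dual :: "('q, 'p) wts \<Rightarrow> ('q dual_state, 'p) dual_system" where
  "dual T =
     \<lparr>dstates = insert Start {Pair_State a b | a b. (a, b) \<in> trans T},
      dinit = Start,
      dtrans = {(Pair_State a b, Pair_State b c) | a b c. (a, b) \<in> trans T \<and> (b, c) \<in> trans T}
             \<union> {(Start, Pair_State (init T) b) | b. (init T, b) \<in> trans T},
      dlabel = (\<lambda>(s, s'). case s' of Start \<Rightarrow> {} | Pair_State b c \<Rightarrow> label T b),
      duration = (\<lambda>s. case s of Start \<Rightarrow> 0 | Pair_State a b \<Rightarrow> weight T a b)\<rparr>"


section \<open>The region automaton\<close>

type_synonym ('r, 's) region_state = "('r \<Rightarrow> 's) \<times> ('r \<Rightarrow> real)"

record ('x, 'p) region_automaton =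
  rstates :: "'x set"
  rinit :: 'x
  rtrans :: "('x \<times> 'x) set"
  rweight :: "'x \<times> 'x \<Rightarrow> real"
  rlabel :: "'x \<Rightarrow> 'p set"

definition delay ::
    "('r::finite \<Rightarrow> ('s, 'p) dual_system) \<Rightarrow> ('r, 's) region_state \<Rightarrow> real" where
  "delay D = (\<lambda>(q, v). LEAST t. t \<ge> 0 \<and> (\<exists>i. v i + t \<ge> real (duration (D i) (q i))))"

definition expiring ::
    "('r::finite \<Rightarrow> ('s, 'p) dual_system) \<Rightarrow> ('r, 's) region_state \<Rightarrow> 'r set" where
  "expiring D = (\<lambda>(q, v). {i. v i + delay D (q, v) \<ge> real (duration (D i) (q i))})"

definition region_step ::
    "('r::finite \<Rightarrow> ('s, 'p) dual_system)
       \<Rightarrow> (('r, 's) region_state \<times> ('r, 's) region_state) set" where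
  "region_step D = {((q, v), (q', v')).
     \<forall>i. if i \<in> expiring D (q, v)
         then (q i, q' i) \<in> dtrans (D i) \<and> v' i = 0
         else q' i = q i \<and> v' i = v i + delay D (q, v)}"

definition region_init :: "('r::finite \<Rightarrow> ('s, 'p) dual_system) \<Rightarrow> ('r, 's) region_state" where
  "region_init D = (\<lambda>i. dinit (D i), \<lambda>_. 0)"

definition step_label ::
    "('r::finite \<Rightarrow> ('s, 'p) dual_system)
       \<Rightarrow> ('r, 's) region_state \<Rightarrow> ('r, 's) region_state \<Rightarrow> 'p set" where
  "step_label D x x' = (\<Union>i\<in>expiring D x. dlabel (D i) (fst x i, fst x' i))"

text \<open>The label of a state is read off from any transition entering it; lemma
  \<open>step_label_unique\<close> below shows that the choice of the transition does not matter.
  The initial state has no incoming transition, and its label is never used.\<close>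

definition region_automaton ::
    "('r::finite \<Rightarrow> ('s, 'p) dual_system) \<Rightarrow> (('r, 's) region_state, 'p) region_automaton" where
  "region_automaton D =
     (let S = {x. (region_init D, x) \<in> (region_step D)\<^sup>*};
          E = region_step D \<inter> S \<times> S in
      \<lparr>rstates = S,
       rinit = region_init D,
       rtrans = E,
       rweight = (\<lambda>(x, x'). delay D x),
       rlabel = (\<lambda>x'. THE l. \<exists>x. (x, x') \<in> E \<and> l = step_label D x x')\<rparr>)"

definition region_run :: "('x, 'p) region_automaton \<Rightarrow> (nat \<Rightarrow> 'x) \<Rightarrow> bool" where
  "region_run R \<rho> \<longleftrightarrow> \<rho> 0 = rinit R \<and> (\<forall>k. (\<rho> k, \<rho> (Suc k)) \<in> rtrans R)"

definition region_word :: "('x, 'p) region_automaton \<Rightarrow> (nat \<Rightarrow> 'x) \<Rightarrow> nat \<Rightarrow> 'p set" where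
  "region_word R \<rho> k = rlabel R (\<rho> (Suc k))"

definition region_time :: "('x, 'p) region_automaton \<Rightarrow> (nat \<Rightarrow> 'x) \<Rightarrow> nat \<Rightarrow> real" where
  "region_time R \<rho> k = (\<Sum>j\<le>k. rweight R (\<rho> j, \<rho> (Suc j)))"


subsection \<open>State labels are well defined\<close>

lemma delay_eq:
  fixes D :: "'r::finite \<Rightarrow> ('s, 'p) dual_system"
  shows "delay D (q, v) = max 0 (Min (range (\<lambda>i. real (duration (D i) (q i)) - v i)))"
  unfolding delay_def prod.case
proof (rule Least_equality)
  let ?f = "\<lambda>i. real (duration (D i) (q i)) - v i"
  have "Min (range ?f) \<in> range ?f" by (intro Min_in) auto
  then obtain i where "Min (range ?f) = ?f i" by (rule rangeE)
  then show "max 0 (Min (range ?f)) \<ge> 0 \<and>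
      (\<exists>i. v i + max 0 (Min (range ?f)) \<ge> real (duration (D i) (q i)))"
    by (intro conjI exI[of _ i]) auto
next
  let ?f = "\<lambda>i. real (duration (D i) (q i)) - v i"
  fix t assume t: "t \<ge> 0 \<and> (\<exists>i. v i + t \<ge> real (duration (D i) (q i)))"
  then obtain i where "real (duration (D i) (q i)) \<le> v i + t" by blast
  then have "?f i \<le> t" by linarith
  have "Min (range ?f) \<le> ?f i" by (intro Min_le) auto
  then have "Min (range ?f) \<le> t" using \<open>?f i \<le> t\<close> by (rule order_trans)
  then show "max 0 (Min (range ?f)) \<le> t" using t by simp
qed

lemma expiring_iff_clock_zero:
  fixes T :: "'r::finite \<Rightarrow> ('q, 'p) wts"
  defines "D \<equiv> \<lambda>i. dual (T i)"
  assumes wts: "\<And>i. weighted_ts (T i)"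
    and reach: "(region_init D, (q, v)) \<in> (region_step D)\<^sup>*"
    and step: "((q, v), (q', v')) \<in> region_step D"
  shows "expiring D (q, v) = {i. v' i = 0}"
proof -
  define ok where "ok q v \<longleftrightarrow> (\<forall>i. \<exists>a b. q i = Pair_State a b \<and> (a, b) \<in> trans (T i) \<and>
      0 \<le> v i \<and> v i < real (weight (T i) a b))" for q and v :: "'r \<Rightarrow> real"
  have pos: "weight (T i) a b > 0" if "(a, b) \<in> trans (T i)" for i a b
    using wts[of i] that by (auto simp: weighted_ts_def)
  have init: "expiring D (region_init D) = UNIV" "delay D (region_init D) = 0"
    unfolding expiring_def region_init_def prod.case delay_eq
    by (auto simp: D_def dual_def image_constant_conv)
  have delay_pos: "delay D (q, v) > 0" if "ok q v" for q v
  proof -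
    let ?f = "\<lambda>i. real (duration (D i) (q i)) - v i"
    have "?f i > 0" for i
      using that unfolding ok_def D_def dual_def by (auto dest!: spec[of _ i])
    then have "Min (range ?f) > 0" by (subst Min_gr_iff) auto
    then show ?thesis unfolding delay_eq by simp
  qed
  have target: "\<exists>b c. s' = Pair_State b c \<and> (b, c) \<in> trans (T i)"
    if "(s, s') \<in> dtrans (D i)" for s s' i
    using that by (auto simp: D_def dual_def)
  have stay: "v i + delay D (q, v) < real (weight (T i) a b)"
    if "i \<notin> expiring D (q, v)" "q i = Pair_State a b" for q v i a b
    using that by (auto simp: expiring_def D_def dual_def)
  have ok_step: "ok q' v'"
    if "((q, v), (q', v')) \<in> region_step D" "(q, v) = region_init D \<or> ok q v" for q v q' v'
    unfolding ok_def
  proof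
    fix i
    show "\<exists>a b. q' i = Pair_State a b \<and> (a, b) \<in> trans (T i) \<and>
        0 \<le> v' i \<and> v' i < real (weight (T i) a b)"
    proof (cases "i \<in> expiring D (q, v)")
      case True
      then have "(q i, q' i) \<in> dtrans (D i)" "v' i = 0"
        using that(1) unfolding region_step_def by (auto dest!: spec[of _ i])
      then show ?thesis using target pos by fastforce
    next
      case False
      then have "ok q v" using that(2) init(1) by auto
      then obtain a b where ab: "q i = Pair_State a b" "(a, b) \<in> trans (T i)" "0 \<le> v i"
        unfolding ok_def by blast
      have "q' i = q i" "v' i = v i + delay D (q, v)"
        using that(1) False unfolding region_step_def by (auto dest!: spec[of _ i])
      then show ?thesis using ab stay[OF False ab(1)] delay_pos[OF \<open>ok q v\<close>] by auto
    qed
  qed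
  have inv: "x = region_init D \<or> ok (fst x) (snd x)"
    if "(region_init D, x) \<in> (region_step D)\<^sup>*" for x
    using that
  proof (induction rule: rtrancl_induct)
    case (step y z)
    then show ?case using ok_step[of "fst y" "snd y" "fst z" "snd z"] by auto
  qed simp
  have zero: "v' i = 0" if "i \<in> expiring D (q, v)" for i
    using step that unfolding region_step_def by (auto dest!: spec[of _ i])
  have "v' i > 0" if "i \<notin> expiring D (q, v)" for i
  proof -
    have "ok q v" using inv[OF reach] init(1) that by auto
    moreover have "v' i = v i + delay D (q, v)"
      using step that unfolding region_step_def by (auto dest!: spec[of _ i])
    moreover have "0 \<le> v i" using \<open>ok q v\<close> unfolding ok_def by blast
    ultimately show ?thesis using delay_pos by fastforce
  qed
  then show ?thesis using zero by force
qed

lemma step_label_unique: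
  fixes T :: "'r::finite \<Rightarrow> ('q, 'p) wts"
  defines "D \<equiv> \<lambda>i. dual (T i)"
  assumes "\<And>i. weighted_ts (T i)"
    and "(x, z) \<in> rtrans (region_automaton D)" "(y, z) \<in> rtrans (region_automaton D)"
  shows "step_label D x z = step_label D y z"
proof -
  have *: "expiring D u = {i. snd z i = 0}" if "(u, z) \<in> rtrans (region_automaton D)" for u
  proof -
    have "(region_init D, u) \<in> (region_step D)\<^sup>*" "(u, z) \<in> region_step D"
      using that by (simp_all add: region_automaton_def Let_def)
    then show ?thesis
      using expiring_iff_clock_zero[of T "fst u" "snd u" "fst z" "snd z", OF assms(2)]
      by (simp add: D_def)
  qed
  show ?thesis
    unfolding step_label_def *[OF assms(3)] *[OF assms(4)] by (simp add: D_def dual_def)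
qed

lemma rlabel_eq_step_label:
  fixes T :: "'r::finite \<Rightarrow> ('q, 'p) wts"
  defines "D \<equiv> \<lambda>i. dual (T i)"
  assumes "\<And>i. weighted_ts (T i)" and xz: "(x, z) \<in> rtrans (region_automaton D)"
  shows "rlabel (region_automaton D) z = step_label D x z"
proof -
  have "rlabel (region_automaton D) z =
      (THE l. \<exists>x. (x, z) \<in> rtrans (region_automaton D) \<and> l = step_label D x z)"
    by (simp add: region_automaton_def Let_def)
  also have "\<dots> = step_label D x z"
    proof (rule the_equality)
    show "\<exists>y. (y, z) \<in> rtrans (region_automaton D) \<and> step_label D x z = step_label D y z"
      using xz by blast
  next
    fix l assume "\<exists>y. (y, z) \<in> rtrans (region_automaton D) \<and> l = step_label D y z"
    then show "l = step_label D x z"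
      using step_label_unique[of T, OF assms(2)] xz unfolding D_def by blast
  qed
  finally show ?thesis .
qed

end

(* At a time t, each robot i is between two consecutive arrivals a\<^sub>j \<le> t < a\<^sub>j\<^sub>+\<^sub>1. The run of R is obtained by
   sampling, at the successive instants t of the team, the transition q\<^sub>j q\<^sub>j\<^sub>+\<^sub>1 that each robot is taking
   and the time t - a\<^sub>j it has already spent on it. The remaining time of robot i is then a\<^sub>j\<^sub>+\<^sub>1 - t,
   so the delay of R leads exactly to the next instant of the team, and the expiring clocks are those
   of the robots that arrive at that instant. *)

theory Submission
  imports Defs
begin

section \<open>Locating an instant between consecutive arrivals\<close>

definition last_index :: "(nat \<Rightarrow> nat) \<Rightarrow> nat \<Rightarrow> nat" where
  "last_index a t = (LEAST j. t < a (Suc j))"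

lemma last_index:
  assumes "strict_mono a" "a 0 = 0"
  shows "a (last_index a t) \<le> t" "t < a (Suc (last_index a t))"
proof -
  \<comment> \<open>A strictly increasing sequence of naturals satisfies \<open>n \<le> a n\<close>,
    so \<open>j = t\<close> is a witness for the \<open>LEAST\<close>.\<close>
  have "t < a (Suc t)"
    using strict_mono_imp_increasing[OF assms(1), of "Suc t"] by simp
  then show "t < a (Suc (last_index a t))"
    unfolding last_index_def by (rule LeastI)
  show "a (last_index a t) \<le> t"
  proof (cases "last_index a t")
    case (Suc j)
    then have "\<not> t < a (Suc j)"
      unfolding last_index_def by (intro not_less_Least) simp
    then show ?thesis using Suc by simp
  qed (simp add: assms(2))
qed

lemma last_index_eqI:
  assumes "strict_mono a" "a j \<le> t" "t < a (Suc j)"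
  shows "last_index a t = j"
  unfolding last_index_def
proof (rule Least_equality)
  fix k assume "t < a (Suc k)"
  then have "a j < a (Suc k)" using assms(2) by simp
  then show "j \<le> k" using strict_mono_less[OF assms(1)] by simp
qed (rule assms(3))

text \<open>The delay is the least remaining time: \<open>d\<close> exceeds no remaining time and
  equals that of clock \<open>i\<close>, so any \<open>t\<close> that lets some clock expire is at
  least \<open>d\<close>.\<close>

lemma delay_eqI:
  assumes "d \<ge> 0" "\<And>i. v i + d \<le> real (duration (D i) (q i))"
    and "v i + d = real (duration (D i) (q i))"
  shows "delay D (q, v) = d"
  unfolding delay_def prod.case
proof (rule Least_equality)
  show "0 \<le> d \<and> (\<exists>i. real (duration (D i) (q i)) \<le> v i + d)"
    using assms(1) eq_refl[OF assms(3)[symmetric]] by blast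
next
  fix t assume "0 \<le> t \<and> (\<exists>j. real (duration (D j) (q j)) \<le> v j + t)"
  then obtain j where "real (duration (D j) (q j)) \<le> v j + t" by blast
  then show "d \<le> t" using assms(2)[of j] by linarith
qed

section \<open>The sampled run and the instants of the team\<close>

locale team =
  fixes T :: "'r::finite \<Rightarrow> ('q, 'p) wts" and r :: "'r \<Rightarrow> nat \<Rightarrow> 'q"
  assumes wts: "weighted_ts (T i)" and run: "is_run (T i) (r i)"
begin

abbreviation D :: "'r \<Rightarrow> ('q dual_state, 'p) dual_system" where
  "D \<equiv> \<lambda>i. dual (T i)"

abbreviation arr :: "'r \<Rightarrow> nat \<Rightarrow> nat" where
  "arr i \<equiv> arrival (T i) (r i)"

abbreviation idx :: "'r \<Rightarrow> nat \<Rightarrow> nat" where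
  "idx i \<equiv> last_index (arr i)"

text \<open>At an arrival instant \<open>idx\<close> already points to the state just reached, so
  the robot is recorded on its next transition with clock 0.\<close>

definition sample :: "nat \<Rightarrow> ('r, 'q dual_state) region_state" where
  "sample t = (\<lambda>i. Pair_State (r i (idx i t)) (r i (Suc (idx i t))),
               \<lambda>i. real t - real (arr i (idx i t)))"

text \<open>The index is shifted by one because position 0 holds the dummy initial state, left at
  time 0.\<close>

definition team_run :: "nat \<Rightarrow> ('r, 'q dual_state) region_state" where
  "team_run k = (case k of 0 \<Rightarrow> region_init D | Suc j \<Rightarrow> sample (team_time T r j))"

lemma run_trans: "(r i k, r i (Suc k)) \<in> trans (T i)"
  using run by (simp add: is_run_def)

lemma strict_mono_arr: "strict_mono (arr i)"
  using wts[of i] run_trans[of i] by (fastforce simp: strict_mono_Suc_iff weighted_ts_def)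

lemma idx: "arr i (idx i t) \<le> t" "t < arr i (Suc (idx i t))"
  using last_index[OF strict_mono_arr] by simp_all

lemma idx_arr [simp]: "idx i (arr i j) = j"
  using strict_mono_arr by (intro last_index_eqI) (auto simp: strict_mono_Suc_iff)

lemma arr_in_team_instants [simp]: "arr i j \<in> team_instants T r"
  by (auto simp: team_instants_def)

lemma infinite_instants: "infinite (team_instants T r)"
  using wts run by (rule infinite_team_instants)

lemma team_time_0: "team_time T r 0 = 0"
  unfolding team_time_def enumerate_0
  by (rule Least_eq_0) (metis arr_in_team_instants arrival.simps(1))

lemma team_time_in: "\<exists>i j. team_time T r k = arr i j"
  using enumerate_in_set[OF infinite_instants, of k]
  by (auto simp: team_time_def team_instants_def)

lemma team_time_less: "team_time T r k < team_time T r (Suc k)"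
  unfolding team_time_def using infinite_instants by (rule enumerate_step)

lemma team_time_Suc_le:
  assumes "team_time T r k < arr i j"
  shows "team_time T r (Suc k) \<le> arr i j"
  using assms unfolding team_time_def enumerate_Suc''[OF infinite_instants]
  by (intro Least_le) simp

text \<open>Arrival times are strictly increasing, so a robot arrives at most once at a given
  instant. The union over pairs \<open>i\<close>, \<open>j\<close> thus becomes one over robots, the
  shape of \<open>step_label\<close>.\<close>

lemma team_word_eq:
  "team_word T r k = (\<Union>i\<in>{i. arr i (idx i (team_time T r k)) = team_time T r k}.
     label (T i) (r i (idx i (team_time T r k))))"
proof -
  have "{label (T i) (r i j) | i j. arr i j = t} =
      (\<lambda>i. label (T i) (r i (idx i t))) ` {i. arr i (idx i t) = t}" for t
  proof (intro equalityI subsetI)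
    fix X assume "X \<in> {label (T i) (r i j) | i j. arr i j = t}"
    then obtain i j where "X = label (T i) (r i j)" "arr i j = t" by blast
    moreover from this(2) have "idx i t = j" by (metis idx_arr)
    ultimately show "X \<in> (\<lambda>i. label (T i) (r i (idx i t))) ` {i. arr i (idx i t) = t}"
      by (intro image_eqI[of _ _ i]) simp_all
  qed blast
  then show ?thesis unfolding team_word_def by presburger
qed

lemma delay_init: "delay D (region_init D) = 0"
  unfolding region_init_def by (rule delay_eqI) (simp_all add: dual_def)

lemma expiring_init: "expiring D (region_init D) = UNIV"
  using delay_init by (simp add: expiring_def region_init_def dual_def)

lemma idx_0: "idx i 0 = 0"
  using idx_arr[of i 0] by simp

lemma region_step_init: "(region_init D, sample 0) \<in> region_step D"
  using expiring_init run_trans[of _ 0] run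
  by (simp add: region_step_def region_init_def sample_def idx_0 dual_def is_run_def)

section \<open>Transitions between consecutive instants of the team\<close>

context
  fixes k t t'
  defines "t \<equiv> team_time T r k" and "t' \<equiv> team_time T r (Suc k)"
begin

lemma next_le: "t' \<le> arr i (Suc (idx i t))"
  unfolding t_def t'_def by (intro team_time_Suc_le idx)

lemma idx_next_eq: "arr i (Suc (idx i t)) = t' \<Longrightarrow> idx i t' = Suc (idx i t)"
  using idx_arr by metis

lemma idx_next_neq:
  assumes "arr i (Suc (idx i t)) \<noteq> t'"
  shows "idx i t' = idx i t"
proof (rule last_index_eqI[OF strict_mono_arr])
  show "arr i (idx i t) \<le> t'"
    using idx(1)[of i t] team_time_less[of k] by (simp add: t_def t'_def)
  show "t' < arr i (Suc (idx i t))"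
    using next_le[of i] assms by simp
qed

text \<open>Links expiry of the current transition with arrival at \<open>t'\<close>. A robot whose
  index did not change made its last arrival no later than \<open>t\<close>, hence before
  \<open>t'\<close>.\<close>

lemma arr_next_iff: "arr i (Suc (idx i t)) = t' \<longleftrightarrow> arr i (idx i t') = t'"
proof
  assume "arr i (idx i t') = t'"
  moreover have "arr i (idx i t) < t'"
    using idx(1)[of i t] team_time_less[of k] by (simp add: t_def t'_def)
  ultimately show "arr i (Suc (idx i t)) = t'"
    using idx_next_neq[of i] by fastforce
qed (simp add: idx_next_eq)

text \<open>Some robot arrives at \<open>t'\<close>, so its current transition ends there; by
  \<open>next_le\<close> no other one ends earlier.\<close>

lemma delay_sample: "delay D (sample t) = real t' - real t"
proof -
  obtain i j where ij: "t' = arr i j"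
    using team_time_in[of "Suc k"] by (auto simp: t'_def)
  then have "arr i (Suc (idx i t)) = t'" unfolding arr_next_iff by simp
  then have "real (arr i (idx i t)) + real (weight (T i) (r i (idx i t)) (r i (Suc (idx i t)))) = real t'"
    by (simp flip: of_nat_add)
  moreover have "real t' \<le> real (arr i (idx i t)) + real (weight (T i) (r i (idx i t)) (r i (Suc (idx i t))))" for i
    using next_le[of i] by (simp flip: of_nat_add)
  moreover have "t < t'" unfolding t_def t'_def by (rule team_time_less)
  ultimately show ?thesis
    unfolding sample_def
    by (intro delay_eqI[where i = i]) (auto simp: dual_def algebra_simps)
qed

lemma expiring_sample: "expiring D (sample t) = {i. arr i (idx i t') = t'}"
proof -
  have "i \<in> expiring D (sample t) \<longleftrightarrow> real (arr i (Suc (idx i t))) \<le> real t'" for i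
    using delay_sample by (simp add: expiring_def sample_def dual_def algebra_simps)
  \<comment> \<open>The reverse inequality is \<open>next_le\<close>, so expiring means ending
    exactly at \<open>t'\<close>.\<close>
  moreover have "real (arr i (Suc (idx i t))) \<le> real t' \<longleftrightarrow> arr i (idx i t') = t'" for i
    using next_le[of i] unfolding of_nat_le_iff arr_next_iff[symmetric] by linarith
  ultimately show ?thesis by auto
qed

lemma region_step_sample: "(sample t, sample t') \<in> region_step D"
proof -
  have "if i \<in> expiring D (sample t)
        then (fst (sample t) i, fst (sample t') i) \<in> dtrans (D i) \<and> snd (sample t') i = 0
        else fst (sample t') i = fst (sample t) i \<and>
          snd (sample t') i = snd (sample t) i + delay D (sample t)" for i
  proof (cases "i \<in> expiring D (sample t)")
    case True
    then have "arr i (idx i t') = t'" by (simp add: expiring_sample)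
    moreover from this have "idx i t' = Suc (idx i t)"
      using idx_next_eq arr_next_iff by blast
    ultimately show ?thesis
      using True run_trans[of i "idx i t"] run_trans[of i "Suc (idx i t)"]
      by (auto simp: sample_def dual_def)
  next
    case False
    then have "idx i t' = idx i t"
      using idx_next_neq arr_next_iff by (auto simp: expiring_sample)
    then show ?thesis using False delay_sample by (simp add: sample_def)
  qed
  then show ?thesis unfolding region_step_def by (simp add: case_prod_beta)
qed

end

section \<open>The run of the region automaton, its word and its times\<close>

lemma team_run_step: "(team_run k, team_run (Suc k)) \<in> region_step D"
  using region_step_init region_step_sample
  by (cases k) (simp_all add: team_run_def team_time_0)

lemma team_run_reachable: "(region_init D, team_run k) \<in> (region_step D)\<^sup>*"
proof (induction k)
  case (Suc k)
  then show ?case using team_run_step by (rule rtrancl_into_rtrancl)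
qed (simp add: team_run_def)

lemma team_run_rtrans: "(team_run k, team_run (Suc k)) \<in> rtrans (region_automaton D)"
  using team_run_step team_run_reachable by (simp add: region_automaton_def Let_def)

lemma region_run_team_run: "region_run (region_automaton D) team_run"
  using team_run_rtrans
  by (simp add: region_run_def) (simp add: region_automaton_def Let_def team_run_def)

text \<open>State \<open>team_run k\<close> is left at instant number \<open>k\<close>. For
  \<open>k = 0\<close> both sides are all robots, since each of them leaves \<open>Start\<close> and
  has its arrival 0 at time 0.\<close>

lemma expiring_team_run:
  "expiring D (team_run k) = {i. arr i (idx i (team_time T r k)) = team_time T r k}"
  by (cases k) (simp_all add: team_run_def expiring_init expiring_sample team_time_0 idx_0)

lemma region_word_team_run: "region_word (region_automaton D) team_run = team_word T r"
proof
  fix k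
  have "region_word (region_automaton D) team_run k = step_label D (team_run k) (team_run (Suc k))"
    unfolding region_word_def using wts team_run_rtrans by (rule rlabel_eq_step_label)
  also have "\<dots> = team_word T r k"
    \<comment> \<open>The dual label depends only on the first component of the target pair, which
      in \<open>sample\<close> is the state of the robot at the new instant.\<close>
    unfolding step_label_def expiring_team_run team_word_eq
    by (simp add: team_run_def sample_def dual_def)
  finally show "region_word (region_automaton D) team_run k = team_word T r k" .
qed

lemma region_time_team_run: "region_time (region_automaton D) team_run k = real (team_time T r k)"
proof -
  \<comment> \<open>The sum telescopes: the first delay is 0 and each later one is a difference of
    consecutive instants.\<close>
  have "(\<Sum>j\<le>k. delay D (team_run j)) = real (team_time T r k)"
    by (induction k) (simp_all add: team_run_def delay_init delay_sample team_time_0)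
  then show ?thesis by (simp add: region_time_def region_automaton_def Let_def)
qed

end

theorem mainTheorem2:
  fixes T :: "'r::finite \<Rightarrow> ('q, 'p) wts"
    and \<Pi> :: "'p set"
    and r :: "'r \<Rightarrow> nat \<Rightarrow> 'q"
  assumes "\<And>i. weighted_ts (T i)"
    and "\<And>i. props (T i) = \<Pi>"
    and "\<And>i. is_run (T i) (r i)"
  defines "R \<equiv> region_automaton (\<lambda>i. dual (T i))"
  shows "\<exists>\<rho>. region_run R \<rho> \<and>
           team_word T r = region_word R \<rho> \<and>
           (\<forall>k. real (team_time T r k) = region_time R \<rho> k)"
proof -
  interpret team T r using assms(1,3) by unfold_locales
  show ?thesis
    unfolding R_def
    using region_run_team_run region_word_team_run region_time_team_run by metis
qed

end
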